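(* For every integer $\ell \ge 1$, every directed graph $G$ in which every vertex has out-degree at least $2\ell$ contains a $(2,\ell)$-spider as a subgraph.
   Context: A directed graph is finite, has no loops, and may contain both edges $(x,y)$ and $(y,x)$ (but no parallel edges in the same direction). For integers $k \ge 2$, $\ell \ge 1$, a $(k,\ell)$-spider is the oriented graph obtained from the in-star with $\ell$ leaves (a central vertex $r$ with $\ell$ edges oriented from the leaves towards $r$) by subdividing each edge $k-1$ times. Thus a $(2,\ell)$-spider consists of a vertex $r$ together with $\ell$ directed paths $x_i \to y_i \to r$ ($1 \le i \le \ell$) on $2\ell+1$ pairwise distinct vertices $r, x_1,y_1,\dots,x_\ell,y_\ell$. *)

theory Defs
  imports "Graph_Theory.Graph_Theory"
begin

datatype spider_vertex = Centre | Leg nat nat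

text \<open>
  \<open>leg_vertex i j\<close> is the vertex of leg \<open>i\<close> at distance \<open>j\<close> from the centre. Subdividing an edge
  of the in-star \<open>k - 1\<close> times turns it into a directed path with \<open>k\<close> edges, hence each leg has
  the vertices with \<open>j = 1, \<dots>, k\<close> besides the centre.
\<close>

definition leg_vertex :: "nat \<Rightarrow> nat \<Rightarrow> spider_vertex" where
  "leg_vertex i j = (if j = 0 then Centre else Leg i j)"

definition spider :: "nat \<Rightarrow> nat \<Rightarrow> (spider_vertex, spider_vertex \<times> spider_vertex) pre_digraph" where
  "spider k l = \<lparr>
     verts = insert Centre {leg_vertex i j | i j. i < l \<and> j \<le> k},
     arcs = {(leg_vertex i (Suc j), leg_vertex i j) | i j. i < l \<and> j < k},
     tail = fst, head = snd \<rparr>"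

lemma digraph_spider: "digraph (spider k l)"
proof -
  have V: "verts (spider k l) = insert Centre ((\<lambda>(i, j). leg_vertex i j) ` ({..<l} \<times> {..k}))"
    by (auto simp: spider_def)
  have A: "arcs (spider k l) =
      (\<lambda>(i, j). (leg_vertex i (Suc j), leg_vertex i j)) ` ({..<l} \<times> {..<k})"
    by (auto simp: spider_def)
  have th: "tail (spider k l) = fst" "head (spider k l) = snd"
    by (simp_all add: spider_def)
  show ?thesis
  proof
    show "finite (verts (spider k l))" "finite (arcs (spider k l))"
      unfolding V A by simp_all
  next
    fix e assume "e \<in> arcs (spider k l)"
    then obtain i j where e: "e = (leg_vertex i (Suc j), leg_vertex i j)" "i < l" "j < k"
      unfolding A by auto
    then have "(i, Suc j) \<in> {..<l} \<times> {..k}" "(i, j) \<in> {..<l} \<times> {..k}"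
      by auto
    then show "tail (spider k l) e \<in> verts (spider k l)" "head (spider k l) e \<in> verts (spider k l)"
      unfolding V th e(1) by (metis (mono_tags) case_prod_conv fst_conv snd_conv imageI insertI2)+
    show "tail (spider k l) e \<noteq> head (spider k l) e"
      unfolding th e(1) by (simp add: leg_vertex_def)
  next
    fix e1 e2 assume "arc_to_ends (spider k l) e1 = arc_to_ends (spider k l) e2"
    then show "e1 = e2" by (simp add: arc_to_ends_def th prod_eq_iff)
  qed
qed

lemma verts_spider_2: "l \<ge> 1 \<Longrightarrow>
    verts (spider 2 l) = insert Centre ((\<lambda>i. Leg i 1) ` {..<l} \<union> (\<lambda>i. Leg i 2) ` {..<l})"
  by (auto simp: spider_def leg_vertex_def le_Suc_eq numeral_2_eq_2)

lemma arcs_spider_2: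
  "arcs (spider 2 l) = (\<lambda>i. (Leg i 2, Leg i 1)) ` {..<l} \<union> (\<lambda>i. (Leg i 1, Centre)) ` {..<l}"
  by (auto simp: spider_def leg_vertex_def less_Suc_eq numeral_2_eq_2)

definition contains_copy :: "('a, 'b) pre_digraph \<Rightarrow> ('c, 'd) pre_digraph \<Rightarrow> bool" where
  "contains_copy G S \<longleftrightarrow> (\<exists>H. subgraph H G \<and> digraph_iso S H)"

end

theory Submission
  imports Defs "HOL-Analysis.Function_Topology"
begin

text \<open>
  Let \<open>f\<close> be a stationary distribution of the simple random walk on \<open>G\<close>, let \<open>r\<close> maximise \<open>f\<close>, and
  let \<open>Y\<close> be the in-neighbourhood of \<open>r\<close>. A spider centred at \<open>r\<close> is a matching of size \<open>l\<close> among
  the arcs \<open>e\<close> with head in \<open>Y\<close> and tail different from \<open>r\<close>. Give such an arc the flow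
  \<open>w e = f (tail e) / out_degree (tail e)\<close>. By stationarity the total weight is at least
  \<open>(2 l - 1) f r\<close>, and at most \<open>2 f r\<close> of it meets any given vertex. A set of \<open>2 s + 1 < 2 l\<close>
  vertices spans weight at most \<open>(2 s + 1) (2 s / 2 l) f r \<le> 2 s f r\<close>, because each of its vertices
  sends at most \<open>2 s\<close> of its at least \<open>2 l\<close> arcs into it. So \<open>w / (2 f r)\<close> satisfies the odd-set
  constraints of Edmonds' matching polytope and has total weight greater than \<open>l - 1\<close>; hence a
  matching of size \<open>l\<close> exists.
\<close>

section \<open>Stationary distributions of finite Markov chains\<close>

text \<open>
  The total defect of stationarity attains its minimum on the compact set of distributions, and the
  averages of the first \<open>n\<close> iterates of a distribution have defect at most \<open>2 / n\<close>.
\<close>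

lemma stationary_distribution_exists:
  fixes p :: "'a \<Rightarrow> 'a \<Rightarrow> real"
  assumes fin: "finite V" and ne: "V \<noteq> {}"
    and nonneg: "\<And>u v. u \<in> V \<Longrightarrow> v \<in> V \<Longrightarrow> 0 \<le> p u v"
    and stoch: "\<And>u. u \<in> V \<Longrightarrow> (\<Sum>v\<in>V. p u v) = 1"
  obtains f where "\<And>v. v \<in> V \<Longrightarrow> 0 \<le> f v" "(\<Sum>v\<in>V. f v) = 1"
    "\<And>v. v \<in> V \<Longrightarrow> (\<Sum>u\<in>V. f u * p u v) = f v"
proof -
  define step where "step f v = (if v \<in> V then \<Sum>u\<in>V. f u * p u v else 0)" for f v
  \<comment> \<open>Values outside \<open>V\<close> are pinned to 0, so \<open>K\<close> is a closed
    subset of a product of compact sets over \<open>UNIV\<close>, and Tychonoff's theorem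
    applies.\<close>
  define K :: "('a \<Rightarrow> real) set" where
    "K = (\<Pi>\<^sub>E v\<in>UNIV. if v \<in> V then {0..1} else {0}) \<inter> {f. (\<Sum>v\<in>V. f v) = 1}"
  define D where "D f = (\<Sum>v\<in>V. \<bar>step f v - f v\<bar>)" for f
  have K_iff: "f \<in> K \<longleftrightarrow> (\<forall>v\<in>V. 0 \<le> f v) \<and> (\<forall>v. v \<notin> V \<longrightarrow> f v = 0) \<and> (\<Sum>v\<in>V. f v) = 1" for f
  proof -
    have "f v \<le> 1" if "\<forall>v\<in>V. 0 \<le> f v" "(\<Sum>v\<in>V. f v) = 1" "v \<in> V" for v
      using member_le_sum[of v V f] that fin by auto
    then show ?thesis
      unfolding K_def by (auto simp: PiE_iff split: if_splits)
  qed
  have step_K: "step f \<in> K" if "f \<in> K" for f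
  proof -
    have "(\<Sum>v\<in>V. step f v) = (\<Sum>u\<in>V. \<Sum>v\<in>V. f u * p u v)"
      by (subst sum.swap) (simp add: step_def)
    also have "\<dots> = (\<Sum>u\<in>V. f u)"
      by (simp add: stoch flip: sum_distrib_left)
    finally show ?thesis
      using that nonneg by (auto simp: K_iff step_def intro!: sum_nonneg)
  qed
  have "compact K"
  proof -
    have "compactin (product_topology (\<lambda>_. euclidean) UNIV)
        (\<Pi>\<^sub>E v\<in>UNIV. if v \<in> V then {0..1::real} else {0})"
      by (subst compactin_PiE) auto
    then have "compact (\<Pi>\<^sub>E v\<in>UNIV. if v \<in> V then {0..1::real} else {0})"
      by (simp add: euclidean_product_topology)
    moreover have "closed {f :: 'a \<Rightarrow> real. (\<Sum>v\<in>V. f v) = 1}"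
      by (intro closed_Collect_eq continuous_on_sum continuous_on_product_coordinates
          continuous_on_const)
    ultimately show ?thesis
      unfolding K_def by (rule compact_Int_closed)
  qed
  obtain a where a: "a \<in> V" using ne by blast
  define g0 where "g0 = (\<lambda>v. if v = a then 1 else (0::real))"
  have g0: "g0 \<in> K"
    using fin a by (auto simp: K_iff g0_def)
  have "continuous_on K D"
    unfolding D_def step_def
    by (intro continuous_intros continuous_on_product_coordinates[THEN continuous_on_subset]
        continuous_on_If)
       (auto intro!: continuous_intros continuous_on_product_coordinates[THEN continuous_on_subset])
  then obtain f where f: "f \<in> K" "\<And>g. g \<in> K \<Longrightarrow> D f \<le> D g"
    using continuous_attains_inf[OF \<open>compact K\<close>] g0 by blast
  have small: "D f \<le> 2 / Suc n" for n
  proof -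
    define g where "g k = (step ^^ k) g0" for k
    have g: "g k \<in> K" for k
      by (induction k) (auto simp: g_def g0 step_K)
    define h where "h v = (\<Sum>k\<le>n. g k v) / Suc n" for v
    have hK: "h \<in> K"
    proof -
      have "(\<Sum>v\<in>V. h v) = (\<Sum>k\<le>n. \<Sum>v\<in>V. g k v) / Suc n"
        by (subst sum.swap) (simp add: h_def flip: sum_divide_distrib)
      also have "\<dots> = 1"
        using g by (simp add: K_iff)
      finally show ?thesis
        using g by (auto simp: K_iff h_def intro!: divide_nonneg_nonneg sum_nonneg)
    qed
    \<comment> \<open>\<open>step\<close> is linear and maps \<open>g k\<close> to
      \<open>g (Suc k)\<close>, so the defect of the average telescopes.\<close>
    have step_h: "step h v - h v = (g (Suc n) v - g 0 v) / Suc n" if "v \<in> V" for v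
    proof -
      have "step h v = (\<Sum>u\<in>V. \<Sum>k\<le>n. g k u * p u v) / Suc n"
        using that by (simp add: step_def h_def sum_distrib_right flip: sum_divide_distrib)
      also have "\<dots> = (\<Sum>k\<le>n. g (Suc k) v) / Suc n"
        using that by (subst sum.swap) (simp add: g_def step_def)
      finally have "step h v - h v = (\<Sum>k\<le>n. g (Suc k) v - g k v) / Suc n"
        by (simp add: h_def sum_subtractf diff_divide_distrib)
      then show ?thesis
        using sum_lessThan_telescope[of "\<lambda>k. g k v" "Suc n"] by (simp add: lessThan_Suc_atMost)
    qed
    have "D f \<le> D h" using f hK by blast
    also have "\<dots> = (\<Sum>v\<in>V. \<bar>g (Suc n) v - g 0 v\<bar>) / Suc n"
      by (simp add: D_def step_h abs_divide flip: sum_divide_distrib)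
    \<comment> \<open>The entries are nonnegative and both end distributions have mass 1, whence the
      2.\<close>
    also have "\<dots> \<le> (\<Sum>v\<in>V. g (Suc n) v + g 0 v) / Suc n"
    proof (intro divide_right_mono sum_mono)
      fix v assume "v \<in> V"
      then have "0 \<le> g (Suc n) v" "0 \<le> g 0 v" using g unfolding K_iff by blast+
      then show "\<bar>g (Suc n) v - g 0 v\<bar> \<le> g (Suc n) v + g 0 v" by simp
    qed simp
    also have "\<dots> = 2 / Suc n"
      using g[of 0] g[of "Suc n"] by (simp add: K_iff sum.distrib)
    finally show ?thesis .
  qed
  have "D f = 0"
  proof (rule antisym)
    have "(\<lambda>n. 2 / real (Suc n)) \<longlonglongrightarrow> 0"
      using tendsto_mult_right_zero[OF LIMSEQ_inverse_real_of_nat, of 2]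
      by (simp add: field_simps)
    then show "D f \<le> 0"
      using small by (meson LIMSEQ_le_const)
  qed (simp add: D_def sum_nonneg)
  then have "\<forall>v\<in>V. step f v = f v"
    using fin by (simp add: D_def sum_nonneg_eq_0_iff)
  then show thesis
    using f(1) by (intro that[of f]) (auto simp: K_iff step_def)
qed

section \<open>Matchings and Gallai's lemma\<close>

text \<open>Edges are labels with end sets, not the sets themselves, so that two opposite arcs on
  the same vertices remain distinct edges with separate weights.\<close>

definition matching :: "('e \<Rightarrow> 'a set) \<Rightarrow> 'e set \<Rightarrow> bool" where
  "matching ends M \<longleftrightarrow> (\<forall>e\<in>M. \<forall>f\<in>M. e \<noteq> f \<longrightarrow> ends e \<inter> ends f = {})"

abbreviation covered :: "('e \<Rightarrow> 'a set) \<Rightarrow> 'e set \<Rightarrow> 'a set" where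
  "covered ends M \<equiv> \<Union> (ends ` M)"

lemma card_covered_matching:
  assumes "matching ends M" "finite M" "\<And>e. e \<in> M \<Longrightarrow> card (ends e) = 2"
  shows "card (covered ends M) = 2 * card M"
proof -
  have "finite (ends e)" if "e \<in> M" for e
    using assms(3)[OF that] by (metis card.infinite zero_neq_numeral)
  then have "card (covered ends M) = (\<Sum>e\<in>M. card (ends e))"
    using assms by (intro card_UN_disjoint) (auto simp: matching_def)
  then show ?thesis using assms by simp
qed

lemma matching_insert:
  assumes "matching ends M" "ends e \<inter> covered ends M = {}"
  shows "matching ends (insert e M)"
  using assms by (fastforce simp: matching_def)

lemma matching_subset: "matching ends M \<Longrightarrow> N \<subseteq> M \<Longrightarrow> matching ends N"
  by (auto simp: matching_def)

text \<open>
  Gallai's lemma. Given a maximum matching \<open>M\<close> missing \<open>u\<close> and \<open>z\<close>, take a maximum matching \<open>N\<close>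
  missing \<open>v\<close> with \<open>M \<inter> N\<close> as large as possible; exchanging one edge of \<open>N\<close> enlarges \<open>M \<inter> N\<close>.
\<close>

lemma no_maximum_matching_misses_both_trans:
  assumes fin: "finite E" and ends2: "\<And>e. e \<in> E \<Longrightarrow> card (ends e) = 2"
    and max: "\<And>M. M \<subseteq> E \<Longrightarrow> matching ends M \<Longrightarrow> card M \<le> k"
    and missed: "\<exists>N\<subseteq>E. matching ends N \<and> card N = k \<and> v \<notin> covered ends N"
    and uv: "\<And>M. M \<subseteq> E \<Longrightarrow> matching ends M \<Longrightarrow> card M = k \<Longrightarrow> u \<in> covered ends M \<or> v \<in> covered ends M"
    and vz: "\<And>M. M \<subseteq> E \<Longrightarrow> matching ends M \<Longrightarrow> card M = k \<Longrightarrow> v \<in> covered ends M \<or> z \<in> covered ends M"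
    and "u \<noteq> z" and M: "M \<subseteq> E" "matching ends M" "card M = k"
  shows "u \<in> covered ends M \<or> z \<in> covered ends M"
proof (rule ccontr)
  assume "\<not> ?thesis"
  then have uz: "u \<notin> covered ends M" "z \<notin> covered ends M" by auto
  define P where "P N \<longleftrightarrow> N \<subseteq> E \<and> matching ends N \<and> card N = k \<and> v \<notin> covered ends N" for N
  have "\<exists>N. P N" using missed by (auto simp: P_def)
  moreover have "\<forall>N. P N \<longrightarrow> card (M \<inter> N) < Suc (card E)"
    using fin by (auto simp: P_def less_Suc_eq_le intro!: card_mono)
  ultimately obtain N where N: "P N" and best: "\<And>N'. P N' \<Longrightarrow> card (M \<inter> N') \<le> card (M \<inter> N)"
    using ex_has_greatest_nat[of P _ "\<lambda>N. card (M \<inter> N)"] by blast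
  have finM: "finite M" "finite N"
    using fin M N by (auto simp: P_def intro: finite_subset)
  have fin_ends: "finite (ends e)" if "e \<in> E" for e
    using ends2[OF that] by (metis card.infinite zero_neq_numeral)
  have finc: "finite (covered ends M)" "finite (covered ends N)"
    using finM fin_ends M N by (auto simp: P_def)
  have eq: "card (covered ends M) = card (covered ends N)"
    using M N finM ends2 by (subst (1 2) card_covered_matching) (auto simp: P_def)
  \<comment> \<open>\<open>N\<close> misses \<open>v\<close>, so it covers \<open>u\<close> and
    \<open>z\<close>, which \<open>M\<close> misses. The covered sets have equal size, so
    \<open>M\<close> in turn covers at least two vertices missed by \<open>N\<close>, one of them
    different from \<open>v\<close>.\<close>
  have "u \<in> covered ends N" "z \<in> covered ends N"
    using uv[of N] vz[of N] N by (auto simp: P_def)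
  then have "{u, z} \<subseteq> covered ends N - covered ends M"
    using uz by blast
  then have "card {u, z} \<le> card (covered ends N - covered ends M)"
    using finc by (intro card_mono) auto
  also have "\<dots> = card (covered ends M - covered ends N)"
    using eq finc by (simp add: card_Diff_subset_Int Int_commute)
  finally have two: "2 \<le> card (covered ends M - covered ends N)"
    using \<open>u \<noteq> z\<close> by simp
  have "\<not> covered ends M - covered ends N \<subseteq> {v}"
    using two card_mono[of "{v}" "covered ends M - covered ends N"] by auto
  then obtain x e where x: "x \<noteq> v" "x \<notin> covered ends N" and e: "e \<in> M" "x \<in> ends e"
    by blast
  have eE: "e \<in> E" using e M by auto
  have "e \<notin> N" using x e by auto
  have "ends e \<inter> covered ends N \<noteq> {}"
  proof
    assume "ends e \<inter> covered ends N = {}"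
    then have "card (insert e N) \<le> k"
      using N eE by (intro max matching_insert) (auto simp: P_def)
    then show False
      using \<open>e \<notin> N\<close> finM N by (simp add: P_def)
  qed
  then obtain y f where y: "y \<in> ends e" "y \<in> ends f" and f: "f \<in> N" by blast
  have ends_e: "ends e = {x, y}"
  proof -
    have "x \<noteq> y" using x y f by auto
    then have "card {x, y} = card (ends e)" using ends2[OF eE] by simp
    then show ?thesis
      using card_subset_eq[OF fin_ends[OF eE], of "{x, y}"] e y by auto
  qed
  have "f \<noteq> e" using \<open>e \<notin> N\<close> f by auto
  then have "f \<notin> M" using M e y by (auto simp: matching_def)
  \<comment> \<open>\<open>N'\<close> has the size of \<open>N\<close> and still misses
    \<open>v\<close>, since \<open>x \<noteq> v\<close> and \<open>y\<close> is covered by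
    \<open>N\<close>. As \<open>f\<close> is not in \<open>M\<close>, the exchange adds
    \<open>e\<close> to \<open>M \<inter> N\<close> and removes nothing.\<close>
  define N' where "N' = insert e (N - {f})"
  have "matching ends N'"
    unfolding N'_def
  proof (rule matching_insert)
    show "matching ends (N - {f})" using N by (auto simp: P_def intro: matching_subset)
    have "y \<notin> ends g" if "g \<in> N" "g \<noteq> f" for g
      using N f y that unfolding P_def matching_def by (metis IntI empty_iff)
    then show "ends e \<inter> covered ends (N - {f}) = {}"
      using x ends_e by auto
  qed
  moreover have "card N' = k"
    using f N finM \<open>e \<notin> N\<close> card_Suc_Diff1[of N f] by (simp add: N'_def P_def)
  moreover have "v \<notin> covered ends N'"
    using N x y f ends_e by (auto simp: P_def N'_def)
  ultimately have "P N'"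
    using N eE by (auto simp: P_def N'_def)
  moreover have "M \<inter> N' = insert e (M \<inter> N)"
    using e \<open>f \<notin> M\<close> by (auto simp: N'_def)
  ultimately show False
    using best[of N'] \<open>e \<notin> N\<close> finM by simp
qed

section \<open>The cardinality form of Edmonds' matching polytope theorem\<close>

text \<open>
  The cardinality case of Edmonds' matching polytope theorem. A vertex covered by every maximum matching
  can be deleted. If there is none, the vertices split into the classes of the relation ``no maximum
  matching misses both'', no edge joins two classes, and a maximum matching misses at most one vertex
  of each class.
\<close>

lemma weight_le_maximum_matching:
  fixes w :: "'e \<Rightarrow> real"
  assumes "finite E" "\<And>e. e \<in> E \<Longrightarrow> card (ends e) = 2" "\<And>e. e \<in> E \<Longrightarrow> 0 \<le> w e"
    and "0 \<le> c"
    and "\<And>v. (\<Sum>e | e \<in> E \<and> v \<in> ends e. w e) \<le> c"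
    and "\<And>C s. C \<subseteq> covered ends E \<Longrightarrow> card C = 2 * s + 1 \<Longrightarrow> s \<le> k \<Longrightarrow>
           (\<Sum>e | e \<in> E \<and> ends e \<subseteq> C. w e) \<le> c * s"
    and "\<And>M. M \<subseteq> E \<Longrightarrow> matching ends M \<Longrightarrow> card M \<le> k"
  shows "(\<Sum>e\<in>E. w e) \<le> c * k"
  using assms
proof (induction "card E" arbitrary: E k rule: less_induct)
  case less
  note fin = less.prems(1) and ends2 = less.prems(2) and nonneg = less.prems(3)
    and deg = less.prems(5) and odd = less.prems(6) and max = less.prems(7)
  have fin_ends: "finite (ends e)" if "e \<in> E" for e
    using ends2[OF that] by (metis card.infinite zero_neq_numeral)
  define P where "P M \<longleftrightarrow> M \<subseteq> E \<and> matching ends M" for M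
  have "\<exists>M. P M \<and> (\<forall>N. P N \<longrightarrow> card N \<le> card M)"
    by (rule ex_has_greatest_nat[of P "{}" _ "Suc k"])
      (auto simp: P_def matching_def intro!: le_imp_less_Suc max[unfolded matching_def])
  then obtain M0 where M0: "P M0" and M0_max: "\<And>N. P N \<Longrightarrow> card N \<le> card M0" by blast
  \<comment> \<open>\<open>k\<close> is only an upper bound; both cases work with the exact maximum
    \<open>k'\<close>. A bound \<open>c * k'\<close> suffices because \<open>c\<close> is
    nonnegative.\<close>
  define k' where "k' = card M0"
  have k': "k' \<le> k" using M0 max by (simp add: P_def k'_def)
  have "(\<Sum>e\<in>E. w e) \<le> c * k'"
  proof (cases "\<exists>v. \<forall>M. P M \<and> card M = k' \<longrightarrow> v \<in> covered ends M")
    case True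
    then obtain v where v: "\<And>M. P M \<Longrightarrow> card M = k' \<Longrightarrow> v \<in> covered ends M" by blast
    define E' where "E' = {e \<in> E. v \<notin> ends e}"
    have "v \<in> covered ends M0" using v M0 by (simp add: k'_def)
    then have "E' \<subset> E" "M0 \<noteq> {}" using M0 by (auto simp: E'_def P_def)
    moreover have "finite M0" using M0 fin by (auto simp: P_def intro: finite_subset)
    ultimately have "k' > 0" by (auto simp: k'_def card_gt_0_iff)
    have max': "card M \<le> k' - 1" if "M \<subseteq> E'" "matching ends M" for M
    proof -
      have "P M" "v \<notin> covered ends M" using that by (auto simp: P_def E'_def)
      then have "card M \<le> k'" "card M \<noteq> k'" using M0_max v by (auto simp: k'_def)
      then show ?thesis by simp
    qed
    have mono: "(\<Sum>e | e \<in> E' \<and> Q e. w e) \<le> (\<Sum>e | e \<in> E \<and> Q e. w e)" for Q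
      using fin nonneg by (intro sum_mono2) (auto simp: E'_def)
    \<comment> \<open>Every maximum matching has an edge at \<open>v\<close>, so deleting the edges
      at \<open>v\<close> lowers the maximum, at a cost in weight of at most \<open>c\<close>.
      Positivity of \<open>k'\<close> makes the truncated subtraction exact.\<close>
    have "(\<Sum>e\<in>E'. w e) \<le> c * (k' - 1 :: nat)"
    proof (rule less.hyps)
      show "card E' < card E" using \<open>E' \<subset> E\<close> fin by (rule psubset_card_mono[rotated])
      show "(\<Sum>e | e \<in> E' \<and> u \<in> ends e. w e) \<le> c" for u
        using mono deg by (rule order_trans)
      show "(\<Sum>e | e \<in> E' \<and> ends e \<subseteq> C. w e) \<le> c * s"
        if "C \<subseteq> covered ends E'" "card C = 2 * s + 1" "s \<le> k' - 1" for C s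
      proof (rule order_trans[OF mono odd])
        show "C \<subseteq> covered ends E" using that by (auto simp: E'_def)
      qed (use that k' in auto)
    qed (use fin ends2 nonneg less.prems(4) max' in \<open>auto simp: E'_def\<close>)
    moreover have "(\<Sum>e\<in>E. w e) = (\<Sum>e\<in>E'. w e) + (\<Sum>e | e \<in> E \<and> v \<in> ends e. w e)"
      using fin by (subst sum.union_disjoint[symmetric]) (auto simp: E'_def intro!: sum.cong)
    ultimately show ?thesis
      using deg[of v] \<open>k' > 0\<close> by (simp add: of_nat_diff algebra_simps)
  next
    case False
    define V where "V = covered ends E"
    have finV: "finite V" using fin fin_ends by (auto simp: V_def)
    \<comment> \<open>The diagonal is added by hand: in this case each vertex is missed by some
      maximum matching, so the second condition alone would be irreflexive.\<close>
    define R where "R = {(u, v). u \<in> V \<and> v \<in> V \<and>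
      (u = v \<or> (\<forall>M. P M \<and> card M = k' \<longrightarrow> u \<in> covered ends M \<or> v \<in> covered ends M))}"
    have "trans R"
    proof (rule transI)
      fix x y z assume xy: "(x, y) \<in> R" "(y, z) \<in> R"
      show "(x, z) \<in> R"
      proof (cases "x = y \<or> y = z \<or> x = z")
        case True
        then show ?thesis using xy by (auto simp: R_def)
      next
        case neq: False
        have "x \<in> covered ends M \<or> z \<in> covered ends M" if "P M" "card M = k'" for M
          by (rule no_maximum_matching_misses_both_trans[where E = E and v = y and k = k'])
            (use fin ends2 M0_max[folded k'_def] False xy neq that in
              \<open>(simp add: P_def R_def; blast)+\<close>)
        then show ?thesis using xy by (auto simp: R_def)
      qed
    qed
    then have equiv: "equiv V R"
      by (auto intro!: equivI refl_onI symI simp: R_def)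
    \<comment> \<open>A maximum matching missing both ends of \<open>e\<close> could be enlarged by
      \<open>e\<close>.\<close>
    have edge: "(a, b) \<in> R" if e: "e \<in> E" "ends e = {a, b}" for e a b
    proof (rule ccontr)
      assume "(a, b) \<notin> R"
      moreover have "a \<in> V" "b \<in> V" using e by (auto simp: V_def)
      ultimately obtain M where M: "P M" "card M = k'" "a \<notin> covered ends M" "b \<notin> covered ends M"
        by (auto simp: R_def)
      then have "P (insert e M)"
        using e by (auto simp: P_def intro!: matching_insert)
      then have "card (insert e M) \<le> k'" using M0_max k'_def by simp
      moreover have "e \<notin> M" "finite M"
        using M e fin by (auto simp: P_def intro: finite_subset)
      ultimately show False using M by simp
    qed
    have in_class: "\<exists>C\<in>V // R. ends e \<subseteq> C" if "e \<in> E" for e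
    proof -
      obtain a b where ab: "ends e = {a, b}"
        using ends2[OF \<open>e \<in> E\<close>] by (meson card_2_iff)
      then have "(a, b) \<in> R" using edge that by blast
      then have "{a, b} \<subseteq> R `` {a}" "a \<in> V"
        using equiv by (auto simp: equiv_def refl_on_def R_def)
      then show ?thesis using ab by (auto intro: quotientI)
    qed
    have finQ: "finite (V // R)"
      using finV equiv by (simp add: finite_quotient equiv_type)
    \<comment> \<open>The ends of an edge lie in exactly one class. The identity serves for the
      weight on \<open>E\<close> and, with the constant 1, for counting \<open>M0\<close>.\<close>
    have split: "(\<Sum>e\<in>F. g e) = (\<Sum>C\<in>V // R. \<Sum>e | e \<in> F \<and> ends e \<subseteq> C. g e)"
      if "F \<subseteq> E" for F and g :: "'e \<Rightarrow> real"
    proof -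
      have "(\<Sum>e\<in>F. g e) = (\<Sum>e\<in>(\<Union>C\<in>V // R. {e \<in> F. ends e \<subseteq> C}). g e)"
        using in_class that by (intro sum.cong) auto
      also have "\<dots> = (\<Sum>C\<in>V // R. \<Sum>e | e \<in> F \<and> ends e \<subseteq> C. g e)"
      proof (rule sum.UNION_disjoint[OF finQ])
        show "\<forall>C\<in>V // R. finite {e \<in> F. ends e \<subseteq> C}"
          using that fin by (auto intro: finite_subset)
        show "\<forall>C\<in>V // R. \<forall>C'\<in>V // R. C \<noteq> C' \<longrightarrow> {e \<in> F. ends e \<subseteq> C} \<inter> {e \<in> F. ends e \<subseteq> C'} = {}"
        proof (intro ballI impI equals0I)
          fix C C' e assume C: "C \<in> V // R" "C' \<in> V // R" "C \<noteq> C'"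
            and e: "e \<in> {e \<in> F. ends e \<subseteq> C} \<inter> {e \<in> F. ends e \<subseteq> C'}"
          have "C \<inter> C' = {}" using quotient_disj[OF equiv C(1,2)] C(3) by blast
          then have "ends e = {}" using e by blast
          then show False using ends2[of e] e that by auto
        qed
      qed
      finally show ?thesis .
    qed
    have class_bound: "(\<Sum>e | e \<in> E \<and> ends e \<subseteq> C. w e) \<le> c * card {e \<in> M0. ends e \<subseteq> C}"
      if C: "C \<in> V // R" for C
    proof -
      define m where "m = card {e \<in> M0. ends e \<subseteq> C}"
      define S where "S = covered ends {e \<in> M0. ends e \<subseteq> C}"
      have CV: "C \<subseteq> V" using C equiv by (meson equiv_type in_quotient_imp_subset)
      then have finC: "finite C" using finV by (rule finite_subset)
      have finM0: "finite M0" using M0 fin by (auto simp: P_def intro: finite_subset)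
      have S: "S \<subseteq> C" "card S = 2 * m"
        unfolding S_def m_def using M0 finM0 ends2
        by (auto simp: P_def intro!: card_covered_matching intro: matching_subset)
      \<comment> \<open>An edge of \<open>M0\<close> meeting \<open>C\<close> lies inside
        \<open>C\<close>, so \<open>S\<close> is the whole part of \<open>C\<close> that
        \<open>M0\<close> covers.\<close>
      have S_eq: "x \<in> S" if x: "x \<in> C" "x \<in> covered ends M0" for x
      proof -
        obtain e where e: "e \<in> M0" "x \<in> ends e" using x by blast
        then obtain C' where C': "C' \<in> V // R" "ends e \<subseteq> C'"
          using in_class[of e] M0 unfolding P_def by blast
        then have "C' = C" using quotient_disj[OF equiv C C'(1)] e that by blast
        then show ?thesis using e C' by (auto simp: S_def)
      qed
      have "x = y" if "x \<in> C - S" "y \<in> C - S" for x y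
      proof -
        have "(x, y) \<in> R"
          using that C equiv by (meson DiffD1 quotient_eq_iff quotient_eqI in_quotient_imp_in_rel
              empty_subsetI insert_subset)
        moreover have "x \<notin> covered ends M0" "y \<notin> covered ends M0"
          using that S_eq by auto
        ultimately show ?thesis using M0 by (auto simp: R_def k'_def)
      qed
      then have "card (C - S) \<le> 1"
        using finC by (auto simp: card_le_Suc0_iff_eq)
      moreover have "card (C - S) = card C - 2 * m" "2 * m \<le> card C"
        using S finC card_mono[OF finC S(1)] by (auto simp: card_Diff_subset finite_subset)
      ultimately consider "card C = 2 * m" | "card C = 2 * m + 1" by linarith
      \<comment> \<open>An even class is handled by double counting with the degree bound, an odd
        one by the odd-set hypothesis with \<open>s = m\<close>.\<close>
      then have "(\<Sum>e | e \<in> E \<and> ends e \<subseteq> C. w e) \<le> c * m"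
      proof cases
        case 1
        have "2 * (\<Sum>e | e \<in> E \<and> ends e \<subseteq> C. w e) = (\<Sum>e | e \<in> E \<and> ends e \<subseteq> C. \<Sum>v\<in>ends e. w e)"
          using ends2 by (simp add: sum_distrib_left)
        also have "\<dots> = (\<Sum>e | e \<in> E \<and> ends e \<subseteq> C. \<Sum>v | v \<in> C \<and> v \<in> ends e. w e)"
          by (intro sum.cong) auto
        also have "\<dots> = (\<Sum>v\<in>C. \<Sum>e | e \<in> {e \<in> E. ends e \<subseteq> C} \<and> v \<in> ends e. w e)"
          using fin finC by (intro sum.swap_restrict) auto
        also have "\<dots> \<le> (\<Sum>v\<in>C. \<Sum>e | e \<in> E \<and> v \<in> ends e. w e)"
          using fin nonneg by (intro sum_mono sum_mono2) auto
        also have "\<dots> \<le> (\<Sum>v\<in>C. c)"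
          by (intro sum_mono deg)
        finally show ?thesis using 1 by (simp add: mult.commute)
      next
        case 2
        have "m \<le> k'" unfolding m_def k'_def using finM0 by (intro card_mono) auto
        then show ?thesis using 2 k' CV by (intro odd) (auto simp: V_def)
      qed
      then show ?thesis by (simp add: m_def)
    qed
    have "(\<Sum>e\<in>E. w e) \<le> (\<Sum>C\<in>V // R. c * card {e \<in> M0. ends e \<subseteq> C})"
      unfolding split[OF order_refl] by (intro sum_mono class_bound)
    also have "\<dots> = c * (\<Sum>C\<in>V // R. \<Sum>e | e \<in> M0 \<and> ends e \<subseteq> C. 1)"
      by (simp add: sum_distrib_left)
    also have "\<dots> = c * k'"
      using M0 by (subst split[symmetric]) (auto simp: P_def k'_def)
    finally show ?thesis .
  qed
  also have "\<dots> \<le> c * k"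
    using k' less.prems(4) by (intro mult_left_mono) auto
  finally show ?case .
qed

section \<open>Spiders from matchings\<close>

text \<open>An arc of \<open>M\<close> is the outer arc of a leg, and \<open>to_r\<close> provides
  the inner one. The matching property keeps the \<open>2 * l\<close> leg vertices distinct; tails
  avoid \<open>r\<close> by \<open>tail_ne\<close>, heads because the inner arcs are not
  loops.\<close>

lemma contains_spider_2_if_matching:
  fixes G :: "('a, 'b) pre_digraph"
  assumes "digraph G" and l: "l \<ge> 1" and r: "r \<in> verts G"
    and M: "M \<subseteq> arcs G" "card M = l"
    and match: "matching (\<lambda>e. {tail G e, head G e}) M"
    and tail_ne: "\<And>e. e \<in> M \<Longrightarrow> tail G e \<noteq> r"
    and to_r: "\<And>e. e \<in> M \<Longrightarrow> \<exists>a\<in>arcs G. tail G a = head G e \<and> head G a = r"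
  shows "contains_copy G (spider 2 l)"
proof -
  interpret G: digraph G by fact
  interpret S: digraph "spider 2 l" by (rule digraph_spider)
  have "finite M" using M by (auto intro: finite_subset)
  then obtain m where m: "bij_betw m {..<l} M"
    using ex_bij_betw_nat_finite[of M] M by (auto simp: atLeast0LessThan)
  then have mM: "m i \<in> M" if "i < l" for i
    using that by (auto simp: bij_betw_def)
  have m_inj: "m i = m j \<longleftrightarrow> i = j" if "i < l" "j < l" for i j
    using m that by (auto simp: bij_betw_def inj_on_def)
  obtain g where g: "\<And>e. e \<in> M \<Longrightarrow> g e \<in> arcs G" "\<And>e. e \<in> M \<Longrightarrow> tail G (g e) = head G e"
    "\<And>e. e \<in> M \<Longrightarrow> head G (g e) = r"
    using to_r by metis
  define \<phi> where "\<phi> x = (case x of Centre \<Rightarrow> r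
    | Leg i j \<Rightarrow> if j = 1 then head G (m i) else tail G (m i))" for x
  \<comment> \<open>Every spider arc starts at a leg vertex, and its tail tells which arc it is:
    \<open>j = 1\<close> gives the arc into the centre, \<open>j = 2\<close> the outer arc of the
    leg.\<close>
  define \<psi> where "\<psi> a = (case fst a of Leg i j \<Rightarrow> if j = 1 then g (m i) else m i)"
    for a :: "spider_vertex \<times> spider_vertex"
  define hom where "hom = \<lparr>iso_verts = \<phi>, iso_arcs = \<psi>, iso_head = head G, iso_tail = tail G\<rparr>"
  have arcM: "e \<in> arcs G" "tail G e \<noteq> head G e" "head G e \<noteq> r" if "e \<in> M" for e
    using that M G.no_loops to_r[OF that] by (auto dest: G.no_loops)
  have disj: "tail G (m i) \<noteq> tail G (m j)" "head G (m i) \<noteq> head G (m j)"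
    "tail G (m i) \<noteq> head G (m j)" if "i < l" "j < l" "i \<noteq> j" for i j
    using match mM that m_inj[of i j] unfolding matching_def by fastforce+
  have V: "verts (spider 2 l) = insert Centre ((\<lambda>i. Leg i 1) ` {..<l} \<union> (\<lambda>i. Leg i 2) ` {..<l})"
    using l by (rule verts_spider_2)
  have inj_\<phi>: "inj_on \<phi> (verts (spider 2 l))"
  proof (rule inj_onI)
    fix x y assume "x \<in> verts (spider 2 l)" "y \<in> verts (spider 2 l)" "\<phi> x = \<phi> y"
    then show "x = y"
      unfolding V using disj arcM mM tail_ne by (auto simp: \<phi>_def) (metis+)
  qed
  have ends: "\<phi> (fst a) = tail G (\<psi> a) \<and> \<phi> (snd a) = head G (\<psi> a) \<and> \<psi> a \<in> arcs G"
    if "a \<in> arcs (spider 2 l)" for a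
    using that mM g arcM by (auto simp: arcs_spider_2 \<phi>_def \<psi>_def)
  have th: "tail (spider 2 l) = fst" "head (spider 2 l) = snd"
    by (simp_all add: spider_def)
  \<comment> \<open>A spider arc is the pair of its ends, so injectivity on vertices carries over to
    arcs.\<close>
  have inj_\<psi>: "inj_on \<psi> (arcs (spider 2 l))"
  proof (rule inj_onI)
    fix a b assume ab: "a \<in> arcs (spider 2 l)" "b \<in> arcs (spider 2 l)" "\<psi> a = \<psi> b"
    then have "\<phi> (fst a) = \<phi> (fst b)" "\<phi> (snd a) = \<phi> (snd b)" using ends by metis+
    moreover have "fst a \<in> verts (spider 2 l)" "fst b \<in> verts (spider 2 l)"
      "snd a \<in> verts (spider 2 l)" "snd b \<in> verts (spider 2 l)"
      using ab S.tail_in_verts S.head_in_verts unfolding th by auto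
    ultimately show "a = b"
      using inj_\<phi> by (auto simp: inj_on_def prod_eq_iff)
  qed
  have iso: "S.digraph_isomorphism hom"
    using inj_\<phi> inj_\<psi> ends S.wf_digraph by (simp add: S.digraph_isomorphism_def hom_def th)
  have "subgraph (app_iso hom (spider 2 l)) G"
    unfolding subgraph_def
  proof (intro conjI)
    show "verts (app_iso hom (spider 2 l)) \<subseteq> verts G"
      using mM arcM r by (auto simp: hom_def \<phi>_def V)
    show "arcs (app_iso hom (spider 2 l)) \<subseteq> arcs G"
      using ends by (auto simp: hom_def)
    show "wf_digraph (app_iso hom (spider 2 l))"
      using iso by (rule S.wf_digraphI_app_iso)
  qed (auto simp: compatible_def hom_def G.wf_digraph)
  then show ?thesis
    using iso by (auto simp: contains_copy_def digraph_iso_def)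
qed

section \<open>The flow of the random walk and its matching constraints\<close>

theorem theorem1p2:
  fixes G :: "('a, 'b) pre_digraph" and l :: nat
  assumes "l \<ge> 1"
    and "digraph G"
    and "verts G \<noteq> {}"
    and "\<forall>v \<in> verts G. out_degree G v \<ge> 2 * l"
  shows "contains_copy G (spider 2 l)"
proof (rule ccontr)
  assume no_copy: "\<not> contains_copy G (spider 2 l)"
  interpret digraph G by fact
  let ?ends = "\<lambda>e. {tail G e, head G e}"
  define d where "d v = real (out_degree G v)" for v
  have d: "d v \<ge> 2 * l" "d v > 0" if "v \<in> verts G" for v
    using assms(1,4) that by (force simp: d_def)+
  have out_sum: "(\<Sum>e\<in>out_arcs G v. x / d (tail G e)) = x" if "v \<in> verts G" for v x
  proof -
    have "(\<Sum>e\<in>out_arcs G v. x / d (tail G e)) = (\<Sum>e\<in>out_arcs G v. x / d v)"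
      by (intro sum.cong) (auto simp: out_arcs_def)
    then show ?thesis using d(2)[OF that] by (simp add: d_def out_degree_def)
  qed
  \<comment> \<open>Without parallel arcs the sum has at most one term; this form lets row sums and
    flows be computed by grouping arcs by head or tail.\<close>
  define p where "p u v = (\<Sum>e | e \<in> out_arcs G u \<and> head G e = v. 1 / d (tail G e))" for u v
  obtain f where f_nonneg: "\<And>v. v \<in> verts G \<Longrightarrow> 0 \<le> f v"
    and f_sum: "(\<Sum>v\<in>verts G. f v) = 1"
    and f_stat: "\<And>v. v \<in> verts G \<Longrightarrow> (\<Sum>u\<in>verts G. f u * p u v) = f v"
  proof (rule stationary_distribution_exists[of "verts G" p])
    show "0 \<le> p u v" if "u \<in> verts G" "v \<in> verts G" for u v
      by (auto simp: p_def d_def intro!: sum_nonneg)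
    show "(\<Sum>v\<in>verts G. p u v) = 1" if "u \<in> verts G" for u
      unfolding p_def using out_sum[OF that, of 1]
      by (subst sum.group) (auto simp: out_arcs_def)
  qed (use assms(3) in auto)
  define w where "w e = f (tail G e) / d (tail G e)" for e
  have w_nonneg: "0 \<le> w e" if "e \<in> arcs G" for e
    using that f_nonneg d by (auto simp: w_def d_def)
  have w_out: "(\<Sum>e\<in>out_arcs G v. w e) = f v" if "v \<in> verts G" for v
    using out_sum[OF that, of "f v"] by (simp add: w_def out_arcs_def)
  have w_in: "(\<Sum>e\<in>in_arcs G v. w e) = f v" if "v \<in> verts G" for v
  proof -
    have "(\<Sum>e\<in>in_arcs G v. w e) = (\<Sum>u\<in>verts G. \<Sum>e | e \<in> in_arcs G v \<and> tail G e = u. w e)"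
      by (subst sum.group) (auto simp: in_arcs_def)
    also have "\<dots> = (\<Sum>u\<in>verts G. f u * p u v)"
      unfolding p_def sum_distrib_left
      by (intro sum.cong) (auto simp: w_def in_arcs_def out_arcs_def)
    finally show ?thesis using f_stat that by simp
  qed
  obtain r where r: "r \<in> verts G" and r_max: "\<And>v. v \<in> verts G \<Longrightarrow> f v \<le> f r"
    using obtains_MAX[of "verts G" f] assms(3) by (metis Max_ge finite_imageI finite_verts imageI)
  have "f r > 0"
  proof (rule ccontr)
    assume "\<not> f r > 0"
    then have "(\<Sum>v\<in>verts G. f v) \<le> 0"
      using r_max by (intro sum_nonpos) force
    then show False using f_sum by simp
  qed
  define Y where "Y = tail G ` in_arcs G r"
  have YV: "Y \<subseteq> verts G" by (auto simp: Y_def in_arcs_def)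
  define E where "E = {e \<in> arcs G. head G e \<in> Y \<and> tail G e \<noteq> r}"
  have sum_mono_arcs: "(\<Sum>e\<in>A. w e) \<le> (\<Sum>e\<in>B. w e)" if "A \<subseteq> B" "B \<subseteq> arcs G" for A B
    using that w_nonneg by (intro sum_mono2) (auto intro: finite_subset)
  have total: "(2 * real l - 1) * f r \<le> (\<Sum>e\<in>E. w e)"
  proof -
    \<comment> \<open>The flow into \<open>r\<close> is \<open>f r\<close>, and an arc from
      \<open>y\<close> to \<open>r\<close> carries at most \<open>f y / (2 * l)\<close>; hence
      \<open>f\<close> has total at least \<open>2 * l * f r\<close> on \<open>Y\<close>.\<close>
    have "f r * (2 * l) = (\<Sum>e\<in>in_arcs G r. w e * (2 * l))"
      using w_in[OF r] by (simp flip: sum_distrib_right)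
    also have "\<dots> \<le> (\<Sum>e\<in>in_arcs G r. f (tail G e))"
    proof (rule sum_mono)
      fix e assume "e \<in> in_arcs G r"
      then have "tail G e \<in> verts G" by (auto simp: in_arcs_def)
      then show "w e * (2 * l) \<le> f (tail G e)"
        using d[of "tail G e"] f_nonneg[of "tail G e"]
        by (simp add: w_def divide_simps mult_left_mono)
    qed
    also have "\<dots> = (\<Sum>y\<in>Y. f y)"
      unfolding Y_def
      by (subst sum.reindex)
        (auto simp: in_arcs_def inj_on_def arc_to_ends_def intro!: no_multi_arcs)
    also have "\<dots> = (\<Sum>y\<in>Y. \<Sum>e\<in>in_arcs G y. w e)"
      using w_in YV by (intro sum.cong) auto
    also have "\<dots> = (\<Sum>e | e \<in> arcs G \<and> head G e \<in> Y. w e)"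
    proof -
      have "(\<Sum>y\<in>Y. \<Sum>e\<in>in_arcs G y. w e) =
          (\<Sum>y\<in>Y. \<Sum>e | e \<in> {e \<in> arcs G. head G e \<in> Y} \<and> head G e = y. w e)"
        by (intro sum.cong) (auto simp: in_arcs_def)
      then show ?thesis
        using finite_subset[OF YV] by (subst (asm) sum.group) auto
    qed
    \<comment> \<open>Passing to \<open>E\<close> discards only arcs leaving \<open>r\<close>, whose
      total flow is at most \<open>f r\<close>.\<close>
    also have "\<dots> \<le> (\<Sum>e\<in>E \<union> out_arcs G r. w e)"
      by (intro sum_mono_arcs) (auto simp: E_def out_arcs_def)
    also have "\<dots> = (\<Sum>e\<in>E. w e) + f r"
      using w_out[OF r] by (subst sum.union_disjoint) (auto simp: E_def out_arcs_def)
    finally show ?thesis by (simp add: algebra_simps)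
  qed
  \<comment> \<open>The constant \<open>2 * f r\<close> bounds inflow plus outflow at any vertex.
    The resulting \<open>(2 * l - 2) * f r\<close> contradicts \<open>total\<close>, as
    \<open>f r\<close> is positive.\<close>
  have "(\<Sum>e\<in>E. w e) \<le> 2 * f r * (l - 1 :: nat)"
  proof (rule weight_le_maximum_matching[of E ?ends])
    show "finite E" by (simp add: E_def)
    show "card (?ends e) = 2" if "e \<in> E" for e
      using that no_loops[of e] by (simp add: E_def)
    show "0 \<le> w e" if "e \<in> E" for e
      using that w_nonneg by (simp add: E_def)
    show "0 \<le> 2 * f r" using \<open>f r > 0\<close> by simp
    show "(\<Sum>e | e \<in> E \<and> v \<in> ?ends e. w e) \<le> 2 * f r" for v
    proof (cases "v \<in> verts G")
      case True
      have "(\<Sum>e | e \<in> E \<and> v \<in> ?ends e. w e) \<le> (\<Sum>e\<in>out_arcs G v \<union> in_arcs G v. w e)"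
        by (intro sum_mono_arcs) (auto simp: E_def out_arcs_def in_arcs_def)
      also have "\<dots> = (\<Sum>e\<in>out_arcs G v. w e) + (\<Sum>e\<in>in_arcs G v. w e)"
        by (intro sum.union_disjoint) (auto simp: out_arcs_def in_arcs_def dest: no_loops)
      finally show ?thesis using w_in w_out r_max True by force
    next
      case False
      then have "{e. e \<in> E \<and> v \<in> ?ends e} = {}" by (auto simp: E_def)
      then show ?thesis using \<open>f r > 0\<close> by (simp only: sum.empty)
    qed
    show "card M \<le> l - 1" if M: "M \<subseteq> E" "matching ?ends M" for M
    proof (rule ccontr)
      assume "\<not> card M \<le> l - 1"
      then have "l \<le> card M" by simp
      then obtain N where N: "N \<subseteq> M" "card N = l"
        by (meson obtain_subset_with_card_n)
      have "contains_copy G (spider 2 l)"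
      proof (rule contains_spider_2_if_matching)
        fix e assume "e \<in> N"
        then have e: "head G e \<in> Y" "tail G e \<noteq> r" using N M by (auto simp: E_def)
        then show "\<exists>a\<in>arcs G. tail G a = head G e \<and> head G a = r"
          by (force simp: Y_def in_arcs_def)
        show "tail G e \<noteq> r" by (fact e)
      next
        show "matching ?ends N" using M(2) N(1) by (rule matching_subset)
      qed (use assms(1,2) r N M in \<open>auto simp: E_def\<close>)
      then show False using no_copy by contradiction
    qed
    show "(\<Sum>e | e \<in> E \<and> ?ends e \<subseteq> C. w e) \<le> 2 * f r * s"
      if C: "C \<subseteq> covered ?ends E" "card C = 2 * s + 1" and s: "s \<le> l - 1" for C s
    proof -
      have CV: "C \<subseteq> verts G" using C(1) by (auto simp: E_def)
      then have finC: "finite C" by (auto intro: finite_subset)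
      have "(\<Sum>e | e \<in> E \<and> ?ends e \<subseteq> C. w e) \<le> (\<Sum>e | e \<in> arcs G \<and> ?ends e \<subseteq> C. w e)"
        by (intro sum_mono_arcs) (auto simp: E_def)
      also have "\<dots> = (\<Sum>x\<in>C. \<Sum>e | e \<in> {e \<in> arcs G. ?ends e \<subseteq> C} \<and> tail G e = x. w e)"
        using finC by (subst sum.group) auto
      also have "\<dots> \<le> (\<Sum>x\<in>C. f r * s / l)"
      proof (rule sum_mono)
        fix x assume x: "x \<in> C"
        let ?A = "{e. e \<in> {e \<in> arcs G. ?ends e \<subseteq> C} \<and> tail G e = x}"
        have "card ?A \<le> card (C - {x})"
        proof (rule card_inj_on_le)
          show "inj_on (head G) ?A"
            by (auto simp: inj_on_def arc_to_ends_def intro!: no_multi_arcs)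
        qed (use finC in \<open>auto dest: no_loops\<close>)
        then have A: "real (card ?A) \<le> 2 * s" using x finC C(2) by simp
        have "(\<Sum>e\<in>?A. w e) = (\<Sum>e\<in>?A. f x / d x)"
          by (intro sum.cong) (auto simp: w_def)
        also have "\<dots> = card ?A * (f x / d x)" by simp
        also have "\<dots> \<le> (2 * s) * (f r / (2 * l))"
          using x CV d[of x] f_nonneg[of x] r_max[of x] A assms(1)
          by (intro mult_mono frac_le) auto
        finally show "(\<Sum>e\<in>?A. w e) \<le> f r * s / l" by (simp add: mult.commute)
      qed
      also have "\<dots> = (2 * s + 1) * (f r * s / l)" using C(2) by simp
      \<comment> \<open>Here \<open>s \<le> l - 1\<close> enters: \<open>C\<close> has fewer than
        \<open>2 * l\<close> vertices, which cancels the denominator \<open>l\<close>.\<close>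
      also have "\<dots> \<le> (2 * l) * (f r * s / l)"
        using s assms(1) \<open>f r > 0\<close> by (intro mult_right_mono) auto
      also have "\<dots> = 2 * f r * s" using assms(1) by simp
      finally show ?thesis .
    qed
  qed
  then show False
    using total \<open>f r > 0\<close> assms(1) by (simp add: of_nat_diff algebra_simps)
qed

end
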